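(* Under the standing assumptions A1--A4 (see context), let $(u_k)_{k\in\mathbb N}$ be a sequence generated by the proximal gradient algorithm (see context) with starting point $u_0\in\operatorname{dom} g$ and stepsize bounds $0<L_a\le L_b<\infty$. Then for all $k\ge 0$ $$\inf_{\ell\in\{0,\dots,k\}}\ \inf\{\|\nabla f(u_{\ell+1})+\xi\|_{\mathcal U^*} \mid \xi\in\partial g(u_{\ell+1})\}\ \le\ \sqrt{\frac{r_J(u_0)}{\nu(k+1)}},$$ where $$\nu=\min\left\{\frac{L_a}{2(L_{\nabla f}+L_a)^2},\ \frac{L_b}{2(L_{\nabla f}+L_b)^2}\right\}.$$
   Context: Standing assumptions. (A1) $\mathcal U\cong Y^*$, where $Y$ is a separable Banach space with norm $\|\cdot\|_Y$; $\langle\cdot,\cdot\rangle$ is the pairing between $Y$ and $\mathcal U$, and $\mathcal U$ carries the dual norm $\|u\|_{\mathcal U}=\sup_{\|y\|_Y\le1}\langle y,u\rangle$. (A2) $g:\mathcal U\to[0,\infty]$ is proper, convex and sequentially weak* lower semicontinuous. (A3) $f:\mathcal U\to[0,\infty)$ is sequentially weak* lower semicontinuous on $\operatorname{dom}g$, and there are a neighborhood $\mathcal N$ of $\operatorname{dom}g$ in $\mathcal U$ and a map $\nabla f:\operatorname{dom}g\to Y$ such that $f$ is Gâteaux differentiable on $\mathcal N$ with $f'(u)(\delta u)=\langle\nabla f(u),\delta u\rangle$ for all $u\in\operatorname{dom}g$, $\delta u\in\mathcal U$; moreover there is $L_{\nabla f}\ge0$ with $\|\nabla f(u_1)-\nabla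 f(u_2)\|_Y\le L_{\nabla f}\|u_1-u_2\|_{\mathcal U}$ for all $u_1,u_2\in\operatorname{dom}g$. (A4) With $J:=f+g$: if $\|u_k\|_{\mathcal U}\to\infty$ then $J(u_k)\to\infty$. $\mathcal U^*$ is the dual of $\mathcal U$ with its canonical norm; $Y$ is regarded as a subspace of $\mathcal U^*=Y^{**}$ via the canonical isometric embedding. $\partial g(u)\subset\mathcal U^*$ is the convex subdifferential. The residual is $r_J(u):=J(u)-\min_{v\in\mathcal U}J(v)$ (a global minimizer exists under A1--A4). Algorithm. Fix $u_0\in\operatorname{dom}g$ and $0<L_a\le L_b<\infty$. Put $\mathcal Q_L(v,u):=f(u)+\langle\nabla f(u),v-u\rangle+g(v)+\frac L2\|v-u\|_{\mathcal U}^2$. For each $k\in\mathbb N=\{0,1,\dots\}$ choose $u_{k+1}\in\operatorname{arg\,min}_{v\in\mathcal U}\mathcal Q_{L_k}(v,u_k)$, where $L_k$ is such that $L_k\in[L_a,L_b]$ and $J(u_{k+1})\le\mathcal Q_{L_k}(u_{k+1},u_k)$. *)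

theory Defs
  imports "HOL-Analysis.Analysis"
begin

text \<open>
  The identification of the space \<open>U\<close> with the dual of \<open>Y\<close> is a map
  \<open>\<Phi> :: 'u \<Rightarrow>\<^sub>L ('y \<Rightarrow>\<^sub>L real)\<close> that is bijective and isometric. The norm of
  \<open>'y \<Rightarrow>\<^sub>L real\<close> is the operator norm, so isometry says exactly that \<open>U\<close> carries the dual norm.
  The canonical embedding below maps \<open>Y\<close> into the dual \<open>'u \<Rightarrow>\<^sub>L real\<close> of \<open>U\<close>.
\<close>

definition dual_identification ::
  "('u::real_normed_vector \<Rightarrow>\<^sub>L ('y::real_normed_vector \<Rightarrow>\<^sub>L real)) \<Rightarrow> bool"
  where "dual_identification \<Phi> \<longleftrightarrow> bij (blinfun_apply \<Phi>) \<and> (\<forall>u. norm (\<Phi> u) = norm u)"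

definition pairing ::
  "('u::real_normed_vector \<Rightarrow>\<^sub>L ('y::real_normed_vector \<Rightarrow>\<^sub>L real)) \<Rightarrow> 'y \<Rightarrow> 'u \<Rightarrow> real"
  where "pairing \<Phi> y u = blinfun_apply (\<Phi> u) y"

lift_definition canonical_embedding ::
  "('u::real_normed_vector \<Rightarrow>\<^sub>L ('y::real_normed_vector \<Rightarrow>\<^sub>L real)) \<Rightarrow> 'y \<Rightarrow> ('u \<Rightarrow>\<^sub>L real)"
  is "\<lambda>\<Phi> y u. pairing \<Phi> y u"
  unfolding pairing_def
  by (rule bounded_linear_compose[OF blinfun.bounded_linear_left blinfun.bounded_linear_right])

definition weakstar_tendsto ::
  "('u::real_normed_vector \<Rightarrow>\<^sub>L ('y::real_normed_vector \<Rightarrow>\<^sub>L real)) \<Rightarrow> (nat \<Rightarrow> 'u) \<Rightarrow> 'u \<Rightarrow> bool"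
  where "weakstar_tendsto \<Phi> x u \<longleftrightarrow> (\<forall>y. (\<lambda>n. pairing \<Phi> y (x n)) \<longlonglongrightarrow> pairing \<Phi> y u)"

definition seq_weakstar_lsc_on ::
  "('u::real_normed_vector \<Rightarrow>\<^sub>L ('y::real_normed_vector \<Rightarrow>\<^sub>L real)) \<Rightarrow> 'u set \<Rightarrow> ('u \<Rightarrow> ereal) \<Rightarrow> bool"
  where "seq_weakstar_lsc_on \<Phi> S h \<longleftrightarrow>
    (\<forall>x u. (\<forall>n. x n \<in> S) \<longrightarrow> u \<in> S \<longrightarrow> weakstar_tendsto \<Phi> x u \<longrightarrow> h u \<le> liminf (\<lambda>n. h (x n)))"

definition edom :: "('u \<Rightarrow> ereal) \<Rightarrow> 'u set"
  where "edom h = {u. h u < \<infinity>}"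

definition proper_fun :: "('u \<Rightarrow> ereal) \<Rightarrow> bool"
  where "proper_fun h \<longleftrightarrow> edom h \<noteq> {} \<and> (\<forall>u. h u \<noteq> -\<infinity>)"

definition convex_fun :: "('u::real_vector \<Rightarrow> ereal) \<Rightarrow> bool"
  where "convex_fun h \<longleftrightarrow>
    (\<forall>u v t. 0 < t \<longrightarrow> t < 1 \<longrightarrow>
      h ((1 - t) *\<^sub>R u + t *\<^sub>R v) \<le> ereal (1 - t) * h u + ereal t * h v)"

definition subdifferential :: "('u::real_normed_vector \<Rightarrow> ereal) \<Rightarrow> 'u \<Rightarrow> ('u \<Rightarrow>\<^sub>L real) set"
  where "subdifferential h u =
    {\<xi>. u \<in> edom h \<and> (\<forall>v. h u + ereal (blinfun_apply \<xi> (v - u)) \<le> h v)}"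

definition has_gateaux_derivative ::
  "('u::real_normed_vector \<Rightarrow> real) \<Rightarrow> ('u \<Rightarrow>\<^sub>L real) \<Rightarrow> 'u \<Rightarrow> bool"
  where "has_gateaux_derivative f D u \<longleftrightarrow>
    (\<forall>d. ((\<lambda>t. (f (u + t *\<^sub>R d) - f u) / t) \<longlongrightarrow> blinfun_apply D d) (at 0))"

definition objective :: "('u \<Rightarrow> real) \<Rightarrow> ('u \<Rightarrow> ereal) \<Rightarrow> 'u \<Rightarrow> ereal"
  where "objective f g u = ereal (f u) + g u"

text \<open>
  The subtrahend is the minimum of the objective whenever that is attained, see the lemma below.
\<close>

definition residual :: "('u \<Rightarrow> real) \<Rightarrow> ('u \<Rightarrow> ereal) \<Rightarrow> 'u \<Rightarrow> ereal"
  where "residual f g u = objective f g u - (INF v. objective f g v)"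

lemma residual_eq_min:
  assumes "is_arg_min (objective f g) (\<lambda>_. True) m"
  shows "residual f g u = objective f g u - objective f g m"
proof -
  have "objective f g m \<le> objective f g v" for v
    using assms by (auto simp: is_arg_min_def not_less)
  then have "(INF v. objective f g v) = objective f g m"
    by (intro antisym INF_greatest INF_lower) auto
  then show ?thesis by (simp add: residual_def)
qed

definition prox_model ::
  "('u::real_normed_vector \<Rightarrow>\<^sub>L ('y::real_normed_vector \<Rightarrow>\<^sub>L real)) \<Rightarrow> ('u \<Rightarrow> real) \<Rightarrow> ('u \<Rightarrow> 'y) \<Rightarrow>
    ('u \<Rightarrow> ereal) \<Rightarrow> real \<Rightarrow> 'u \<Rightarrow> 'u \<Rightarrow> ereal"
  where "prox_model \<Phi> f gradf g L v u =
    ereal (f u + pairing \<Phi> (gradf u) (v - u)) + g v + ereal (L / 2 * (norm (v - u))\<^sup>2)"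

definition prox_grad_sequence ::
  "('u::real_normed_vector \<Rightarrow>\<^sub>L ('y::real_normed_vector \<Rightarrow>\<^sub>L real)) \<Rightarrow> ('u \<Rightarrow> real) \<Rightarrow> ('u \<Rightarrow> 'y) \<Rightarrow>
    ('u \<Rightarrow> ereal) \<Rightarrow> real \<Rightarrow> real \<Rightarrow> (nat \<Rightarrow> 'u) \<Rightarrow> bool"
  where "prox_grad_sequence \<Phi> f gradf g La Lb u \<longleftrightarrow>
    u 0 \<in> edom g \<and>
    (\<forall>k. \<exists>L\<in>{La..Lb}.
      is_arg_min (\<lambda>v. prox_model \<Phi> f gradf g L v (u k)) (\<lambda>_. True) (u (Suc k)) \<and>
      objective f g (u (Suc k)) \<le> prox_model \<Phi> f gradf g L (u (Suc k)) (u k))"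

end

theory Submission
  imports Defs
begin

text \<open>
  Write \<open>D\<close> for the embedded gradient \<open>\<nabla>f(x)\<close> at the current iterate \<open>x\<close>, \<open>w\<close> for the next iterate,
  \<open>L\<close> for the step parameter and \<open>d = \<parallel>w - x\<parallel>\<close>. Two consequences of the minimality of \<open>w\<close> for the
  model carry the proof, and both come from comparing \<open>w\<close> with points \<open>w + t(v - w)\<close> as \<open>t\<close> tends
  to \<open>0\<close> (\<open>prox_first_order\<close>).

  With \<open>v = x\<close> the quadratic term decreases at rate \<open>L d\<^sup>2\<close>, so \<open>g(w) + D(w - x) + L d\<^sup>2 \<le> g(x)\<close>.
  Together with the acceptance test of the algorithm this gives the descent
  \<open>J(x) - J(w) \<ge> (L/2) d\<^sup>2\<close>.

  With arbitrary \<open>v\<close> the quadratic term increases at rate at most \<open>L d \<parallel>v - w\<parallel>\<close>, so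
  \<open>g(w) - L d \<parallel>v - w\<parallel> \<le> g(v) + D(v - w)\<close>. A Hahn-Banach argument (\<open>subgradient_near_functional\<close>)
  turns this slope bound into a subgradient \<open>\<xi>\<close> of \<open>g\<close> at \<open>w\<close> with \<open>\<parallel>D + \<xi>\<parallel> \<le> L d\<close>, whence
  \<open>\<parallel>\<nabla>f(w) + \<xi>\<parallel> \<le> (Lf + L) d\<close> by the Lipschitz bound. The norm is an arbitrary dual norm,
  so neither a Riesz map nor differentiability of the norm is available to produce \<open>\<xi>\<close> explicitly.

  Eliminating \<open>d\<close> gives \<open>J(x) - J(w) \<ge> L / (2 (Lf + L)\<^sup>2) * \<parallel>\<nabla>f(w) + \<xi>\<parallel>\<^sup>2\<close>. The factor first increases
  and then decreases in \<open>L\<close>, so on \<open>[La, Lb]\<close> it is at least the smaller of its endpoint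
  values, which is \<open>\<nu>\<close>. The decreases over \<open>k + 1\<close> steps sum to at most the residual of the starting point,
  so one of them is at most the average.
\<close>

section \<open>Sublinear functionals and the Hahn-Banach theorem\<close>

definition sublinear :: "('a::real_vector \<Rightarrow> real) \<Rightarrow> bool"
  where "sublinear p \<longleftrightarrow>
    (\<forall>x y. p (x + y) \<le> p x + p y) \<and> (\<forall>c x. 0 \<le> c \<longrightarrow> p (c *\<^sub>R x) = c * p x)"

lemma sublinear_add: "sublinear p \<Longrightarrow> p (x + y) \<le> p x + p y"
  and sublinear_scaleR: "sublinear p \<Longrightarrow> 0 \<le> c \<Longrightarrow> p (c *\<^sub>R x) = c * p x"
  by (auto simp: sublinear_def)

lemma sublinear_zero: "sublinear p \<Longrightarrow> p 0 = 0"
  using sublinear_scaleR[of p 0 0] by simp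

lemma sublinear_minus_le: "sublinear p \<Longrightarrow> - p (- x) \<le> p x"
  using sublinear_add[of p x "- x"] sublinear_zero[of p] by simp

text \<open>
  For positive factors one inequality suffices, since the other one is the same inequality for the
  inverse factor. Infima of sublinear functionals satisfy this form directly.
\<close>

lemma sublinearI:
  assumes add: "\<And>x y. p (x + y) \<le> p x + p y"
    and scale: "\<And>c x. 0 < c \<Longrightarrow> p (c *\<^sub>R x) \<le> c * p x"
    and zero: "p 0 = 0"
  shows "sublinear p"
  unfolding sublinear_def
proof (intro conjI allI impI)
  fix c :: real and x
  assume "0 \<le> c"
  show "p (c *\<^sub>R x) = c * p x"
  proof (cases "c = 0")
    case False
    with \<open>0 \<le> c\<close> have "0 < c" by simp
    have "p x \<le> inverse c * p (c *\<^sub>R x)"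
      using scale[of "inverse c" "c *\<^sub>R x"] \<open>0 < c\<close> by simp
    then have "c * p x \<le> p (c *\<^sub>R x)"
      using \<open>0 < c\<close> by (simp add: field_simps)
    with scale[OF \<open>0 < c\<close>, of x] show ?thesis by simp
  qed (simp add: zero)
qed (rule add)

text \<open>
  A sublinear functional can be lowered so as to respect the extra upper bounds \<open>p v \<le> a\<close> for
  \<open>(v, a)\<close> in a convex set, as soon as these do not contradict the lower bound \<open>-q (- v)\<close> which \<open>q\<close>
  forces on every linear functional below it. The witness is the infimal convolution
  of \<open>q\<close> with the cone that the constraints generate.
\<close>

lemma sublinear_below_constraints:
  fixes q :: "'a::real_vector \<Rightarrow> real"
  assumes q: "sublinear q"
    and C: "convex C" "C \<noteq> {}"
    and compat: "\<And>v a. (v, a) \<in> C \<Longrightarrow> - q (- v) \<le> a"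
  obtains p where "sublinear p" "\<And>x. p x \<le> q x" "\<And>v a. (v, a) \<in> C \<Longrightarrow> p v \<le> a"
proof -
  define K where "K = conic hull C"
  have K: "convex_cone K"
    using C by (simp add: K_def convex_cone_def convex_conic_hull conic_conic_hull conic_hull_eq_empty)
  have compat_K: "- q (- fst z) \<le> snd z" if "z \<in> K" for z
  proof -
    obtain c y where "z = c *\<^sub>R y" "0 \<le> c" "y \<in> C"
      using \<open>z \<in> K\<close> unfolding K_def conic_hull_explicit by blast
    then obtain v a where z: "z = c *\<^sub>R (v, a)" "0 \<le> c" "(v, a) \<in> C"
      by (cases y) blast
    have "- (c * q (- v)) \<le> c * a"
      using mult_left_mono[OF compat[OF z(3)] z(2)] by simp
    moreover have "q (- (c *\<^sub>R v)) = c * q (- v)"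
      using sublinear_scaleR[OF q z(2), of "- v"] by simp
    ultimately show ?thesis using z(1) by simp
  qed
  define F where "F x z = q (x - fst z) + snd z" for x z
  define p where "p x = (INF z\<in>K. F x z)" for x
  have F_ge: "- q (- x) \<le> F x z" if "z \<in> K" for x z
    using sublinear_add[OF q, of "x - fst z" "- x"] compat_K[OF that] by (simp add: F_def)
  have p_le: "p x \<le> F x z" if "z \<in> K" for x z
    unfolding p_def using that F_ge by (intro cINF_lower bdd_belowI2[of K "- q (- x)"])
  have K0: "0 \<in> K" and Kne: "K \<noteq> {}"
    using convex_cone_contains_0[OF K] by auto
  have p_ge: "b \<le> p x" if "\<And>z. z \<in> K \<Longrightarrow> b \<le> F x z" for b x
    unfolding p_def using that Kne by (intro cINF_greatest)
  have le_q: "p x \<le> q x" for x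
    using p_le[OF K0, of x] by (simp add: F_def)
  have "sublinear p"
  proof (rule sublinearI)
    fix x y
    have "p (x + y) - F y z' \<le> F x z" if "z \<in> K" "z' \<in> K" for z z'
      using p_le[OF convex_cone_add[OF K that], of "x + y"]
        sublinear_add[OF q, of "x - fst z" "y - fst z'"]
      by (simp add: F_def algebra_simps)
    then have "p (x + y) - F y z' \<le> p x" if "z' \<in> K" for z'
      using that by (intro p_ge)
    then have "p (x + y) - p x \<le> p y"
      by (intro p_ge) (simp add: algebra_simps)
    then show "p (x + y) \<le> p x + p y" by simp
  next
    fix c :: real and x
    assume c: "0 < c"
    have "p (c *\<^sub>R x) / c \<le> F x z" if "z \<in> K" for z
    proof -
      have "F (c *\<^sub>R x) (c *\<^sub>R z) = c * F x z"
        using sublinear_scaleR[OF q, of c "x - fst z"] c by (simp add: F_def algebra_simps)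
      moreover have "c *\<^sub>R z \<in> K"
        using convex_cone_scaleR[OF K _ that] c by simp
      ultimately show ?thesis
        using p_le[of "c *\<^sub>R z" "c *\<^sub>R x"] c by (simp add: field_simps)
    qed
    then have "p (c *\<^sub>R x) / c \<le> p x" by (rule p_ge)
    then show "p (c *\<^sub>R x) \<le> c * p x" using c by (simp add: field_simps)
  next
    show "p 0 = 0"
      using le_q[of 0] p_ge[of "- q (- 0)" 0, OF F_ge] by (simp add: sublinear_zero[OF q])
  qed
  moreover have "p v \<le> a" if "(v, a) \<in> C" for v a
  proof -
    have "(v, a) \<in> K" using that unfolding K_def by (rule hull_inc)
    from p_le[OF this, of v] show ?thesis by (simp add: F_def sublinear_zero[OF q])
  qed
  ultimately show ?thesis using le_q that by blast
qed

text \<open>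
  Zorn's lemma applies because the pointwise infimum of a chain of sublinear functionals below \<open>p\<close>
  is finite, being bounded below by \<open>-p (- x)\<close>, and is again subadditive: of any two members
  of the chain the smaller one can be used for both summands.
\<close>

lemma minimal_sublinear_exists:
  fixes p :: "'a::real_vector \<Rightarrow> real"
  assumes p: "sublinear p"
  obtains m where "sublinear m" "\<And>x. m x \<le> p x"
    "\<And>q. sublinear q \<Longrightarrow> (\<And>x. q x \<le> m x) \<Longrightarrow> q = m"
proof -
  define A where "A = {q. sublinear q \<and> q \<le> p}"
  let ?R = "relation_of (\<lambda>r q. q \<le> r) A"
  have po: "partial_order_on A ?R"
    by (rule partial_order_on_relation_ofI) auto
  have chain_bound: "\<exists>r\<in>A. \<forall>q\<in>Q. r \<le> q" if Q: "Q \<in> Chains ?R" for Q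
  proof (cases "Q = {}")
    case True
    then show ?thesis using p by (auto simp: A_def)
  next
    case False
    have Q_A: "sublinear q" "q x \<le> p x" if "q \<in> Q" for q x
      using Chains_relation_of[OF Q] that by (auto simp: A_def le_fun_def)
    have tot: "q \<le> q' \<or> q' \<le> q" if "q \<in> Q" "q' \<in> Q" for q q'
      using Q that by (auto simp: Chains_def relation_of_def)
    define r where "r x = (INF q\<in>Q. q x)" for x
    have Q_ge: "- p (- x) \<le> q x" if "q \<in> Q" for q x
      using sublinear_minus_le[OF Q_A(1)[OF that], of x] Q_A(2)[OF that, of "- x"] by simp
    have r_le: "r x \<le> q x" if "q \<in> Q" for q x
      unfolding r_def using that Q_ge by (intro cINF_lower bdd_belowI2[of Q "- p (- x)"])
    have r_ge: "b \<le> r x" if "\<And>q. q \<in> Q \<Longrightarrow> b \<le> q x" for b x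
      unfolding r_def using that False by (intro cINF_greatest)
    have "sublinear r"
    proof (rule sublinearI)
      fix x y
      have "r (x + y) - q' y \<le> q x" if "q \<in> Q" "q' \<in> Q" for q q'
        using tot[OF that]
      proof
        assume "q \<le> q'"
        then have "q y \<le> q' y" by (simp add: le_fun_def)
        then show ?thesis
          using r_le[OF that(1), of "x + y"] sublinear_add[OF Q_A(1)[OF that(1)], of x y] by simp
      next
        assume "q' \<le> q"
        then have "q' x \<le> q x" by (simp add: le_fun_def)
        then show ?thesis
          using r_le[OF that(2), of "x + y"] sublinear_add[OF Q_A(1)[OF that(2)], of x y] by simp
      qed
      then have "r (x + y) - q' y \<le> r x" if "q' \<in> Q" for q'
        using that by (intro r_ge)
      then have "r (x + y) - r x \<le> r y"
        by (intro r_ge) (simp add: algebra_simps)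
      then show "r (x + y) \<le> r x + r y" by simp
    next
      fix c :: real and x
      assume c: "0 < c"
      have "r (c *\<^sub>R x) / c \<le> q x" if "q \<in> Q" for q
        using r_le[OF that, of "c *\<^sub>R x"] sublinear_scaleR[OF Q_A(1)[OF that], of c x] c
        by (simp add: field_simps)
      then have "r (c *\<^sub>R x) / c \<le> r x" by (rule r_ge)
      then show "r (c *\<^sub>R x) \<le> c * r x" using c by (simp add: field_simps)
    next
      show "r 0 = 0"
        using False by (simp add: r_def sublinear_zero[OF Q_A(1)])
    qed
    moreover have "r \<le> p"
    proof -
      obtain q where "q \<in> Q" using False by blast
      then show ?thesis by (intro le_funI order_trans[OF r_le Q_A(2)])
    qed
    ultimately show ?thesis using r_le by (auto simp: A_def le_fun_def)
  qed
  obtain m where m: "m \<in> A" "\<And>q. q \<in> A \<Longrightarrow> q \<le> m \<Longrightarrow> q = m"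
    using predicate_Zorn[OF po chain_bound] by auto
  show ?thesis
  proof
    show "sublinear m" "m x \<le> p x" for x
      using m(1) by (auto simp: A_def le_fun_def)
    show "q = m" if "sublinear q" "\<And>x. q x \<le> m x" for q
    proof (rule m(2))
      show "q \<le> m" using that(2) by (simp add: le_fun_def)
      then show "q \<in> A" using that(1) m(1) unfolding A_def by (auto intro: order_trans)
    qed
  qed
qed

text \<open>
  A minimal sublinear functional \<open>m\<close> is odd: the single constraint \<open>p (- y) \<le> - m y\<close> is always
  compatible with \<open>m\<close>, so lowering \<open>m\<close> to respect it cannot change \<open>m\<close>. An odd sublinear
  functional is linear.
\<close>

lemma linear_below_sublinear:
  fixes p :: "'a::real_vector \<Rightarrow> real"
  assumes "sublinear p"
  obtains l where "linear l" "\<And>x. l x \<le> p x"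
proof -
  obtain m where m: "sublinear m" "\<And>x. m x \<le> p x"
    and minimal: "\<And>q. sublinear q \<Longrightarrow> (\<And>x. q x \<le> m x) \<Longrightarrow> q = m"
    using minimal_sublinear_exists[OF assms] by blast
  have odd: "m (- y) = - m y" for y
  proof -
    obtain q where "sublinear q" "\<And>x. q x \<le> m x" "q (- y) \<le> - m y"
      by (rule sublinear_below_constraints[OF m(1), of "{(- y, - m y)}"]) auto
    with minimal have "m (- y) \<le> - m y" by blast
    with sublinear_minus_le[OF m(1), of y] show ?thesis by simp
  qed
  have "linear m"
  proof (rule linearI)
    fix x y
    have "m x \<le> m (x + y) - m y"
      using sublinear_add[OF m(1), of "x + y" "- y"] odd[of y] by simp
    with sublinear_add[OF m(1), of x y] show "m (x + y) = m x + m y" by simp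
  next
    fix c x
    show "m (c *\<^sub>R x) = c *\<^sub>R m x"
    proof (cases "0 \<le> c")
      case True
      then show ?thesis by (simp add: sublinear_scaleR[OF m(1)])
    next
      case False
      then show ?thesis
        using sublinear_scaleR[OF m(1), of "- c" x] odd[of "c *\<^sub>R x"] by simp
    qed
  qed
  then show ?thesis using m(2) that by blast
qed

text \<open>
  The case of the sublinear functional \<open>x \<mapsto> M * norm x\<close>: functionals below it are exactly
  those of norm at most \<open>M\<close>, and compatibility becomes the slope condition.
\<close>

lemma bounded_functional_below_constraints:
  fixes C :: "('a::real_normed_vector \<times> real) set"
  assumes "0 \<le> M" and C: "convex C" "C \<noteq> {}"
    and slope: "\<And>v a. (v, a) \<in> C \<Longrightarrow> - M * norm v \<le> a"
  obtains l :: "'a \<Rightarrow>\<^sub>L real" where "norm l \<le> M" "\<And>v a. (v, a) \<in> C \<Longrightarrow> l v \<le> a"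
proof -
  have "sublinear (\<lambda>x::'a. M * norm x)"
    using \<open>0 \<le> M\<close> mult_left_mono[OF norm_triangle_ineq \<open>0 \<le> M\<close>]
    by (auto simp: sublinear_def distrib_left[symmetric])
  then obtain p where p: "sublinear p" "\<And>x. p x \<le> M * norm x" "\<And>v a. (v, a) \<in> C \<Longrightarrow> p v \<le> a"
    by (rule sublinear_below_constraints[OF _ C]) (use slope in auto)
  obtain l where l: "linear l" "\<And>x. l x \<le> p x"
    using linear_below_sublinear[OF p(1)] by blast
  have abs_le: "norm (l x) \<le> M * norm x" for x
    using l(2)[of x] p(2)[of x] l(2)[of "- x"] p(2)[of "- x"] linear_neg[OF l(1), of x] by auto
  have "bounded_linear l"
    using l(1) abs_le by (intro bounded_linear.intro bounded_linear_axioms.intro exI[of _ M])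
      (auto simp: mult.commute)
  then have apply_l: "blinfun_apply (Blinfun l) = l"
    by (rule bounded_linear_Blinfun_apply)
  show ?thesis
  proof
    show "norm (Blinfun l) \<le> M"
      using abs_le \<open>0 \<le> M\<close> by (intro norm_blinfun_bound) (auto simp: apply_l)
    show "Blinfun l v \<le> a" if "(v, a) \<in> C" for v a
      using l(2)[of v] p(3)[OF that] by (simp add: apply_l)
  qed
qed

section \<open>Subgradients of convex functions\<close>

lemma convex_fun_segment:
  assumes "convex_fun g" "g w \<le> ereal a" "g v \<le> ereal b" "0 < t" "t < 1"
  shows "g ((1 - t) *\<^sub>R w + t *\<^sub>R v) \<le> ereal ((1 - t) * a + t * b)"
proof -
  have "g ((1 - t) *\<^sub>R w + t *\<^sub>R v) \<le> ereal (1 - t) * g w + ereal t * g v"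
    using assms(1,4,5) unfolding convex_fun_def by blast
  also have "\<dots> \<le> ereal (1 - t) * ereal a + ereal t * ereal b"
    using assms by (intro add_mono ereal_mult_left_mono) auto
  finally show ?thesis by simp
qed

text \<open>
  If \<open>g + D\<close> decreases from \<open>w\<close> with slope at most \<open>M\<close> in every direction, then \<open>-D\<close> lies within
  \<open>M\<close> of a subgradient of \<open>g\<close> at \<open>w\<close>. The subgradient comes from a functional of norm at most \<open>M\<close>
  that minorizes the shifted function \<open>v \<mapsto> g v - g w + D (v - w)\<close> as a function of \<open>v - w\<close>;
  the epigraph of that function supplies the constraints, which keeps infinite values of \<open>g\<close> out
  of the separation argument.
\<close>

lemma subgradient_near_functional:
  fixes g :: "'u::real_normed_vector \<Rightarrow> ereal" and D :: "'u \<Rightarrow>\<^sub>L real"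
  assumes cvx: "convex_fun g" and gw: "g w = ereal a" and "0 \<le> M"
    and slope: "\<And>v b. g v \<le> ereal b \<Longrightarrow> a - M * norm (v - w) \<le> b + D (v - w)"
  obtains \<xi> where "\<xi> \<in> subdifferential g w" "norm (D + \<xi>) \<le> M"
proof -
  define C where "C = {z. g (w + fst z) \<le> ereal (a + snd z - D (fst z))}"
  have "convex C"
    unfolding convex_alt
  proof (intro ballI allI impI, elim conjE)
    fix z z' :: "'u \<times> real" and t :: real
    assume z: "z \<in> C" "z' \<in> C" and t: "0 \<le> t" "t \<le> 1"
    show "(1 - t) *\<^sub>R z + t *\<^sub>R z' \<in> C"
    proof (cases "t = 0 \<or> t = 1")
      case False
      with t have "0 < t" "t < 1" by auto
      with convex_fun_segment[OF cvx, of "w + fst z" _ "w + fst z'"] z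
      have "g ((1 - t) *\<^sub>R (w + fst z) + t *\<^sub>R (w + fst z'))
          \<le> ereal ((1 - t) * (a + snd z - D (fst z)) + t * (a + snd z' - D (fst z')))"
        by (simp add: C_def)
      moreover have "(1 - t) *\<^sub>R (w + fst z) + t *\<^sub>R (w + fst z') = w + fst ((1 - t) *\<^sub>R z + t *\<^sub>R z')"
        by (simp add: algebra_simps)
      moreover have "(1 - t) * (a + snd z - D (fst z)) + t * (a + snd z' - D (fst z'))
          = a + snd ((1 - t) *\<^sub>R z + t *\<^sub>R z') - D (fst ((1 - t) *\<^sub>R z + t *\<^sub>R z'))"
        by (simp add: blinfun.add_right blinfun.diff_right blinfun.scaleR_right algebra_simps)
      ultimately show ?thesis by (simp add: C_def)
    qed (use z in auto)
  qed
  moreover have "(0, 0) \<in> C" by (simp add: C_def gw)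
  then have "C \<noteq> {}" by blast
  moreover have "- M * norm x \<le> b" if "(x, b) \<in> C" for x b
    using slope[of "w + x" "a + b - D x"] that by (simp add: C_def)
  ultimately obtain l :: "'u \<Rightarrow>\<^sub>L real" where l: "norm l \<le> M" "\<And>x b. (x, b) \<in> C \<Longrightarrow> l x \<le> b"
    using bounded_functional_below_constraints[OF \<open>0 \<le> M\<close>] by blast
  have "g w + ereal ((l - D) (v - w)) \<le> g v" for v
  proof (cases "g v")
    case (real b)
    then have "(v - w, b - a + D (v - w)) \<in> C" by (simp add: C_def)
    from l(2)[OF this] show ?thesis by (simp add: gw real blinfun.diff_left)
  next
    case MInf
    \<comment> \<open>The slope bound excludes this value: it forces a real lower bound on \<open>g v\<close>.\<close>
    with slope[of v "a - M * norm (v - w) - D (v - w) - 1"] show ?thesis by simp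
  qed simp
  then have "l - D \<in> subdifferential g w"
    by (simp add: subdifferential_def edom_def gw)
  with l(1) show ?thesis by (intro that) auto
qed

section \<open>One step of the proximal gradient method\<close>

text \<open>
  Minimality along the segment from \<open>w\<close> to \<open>v\<close>, divided by \<open>t\<close> and passed to the limit \<open>t \<rightarrow> 0\<close>.
  The number \<open>s\<close> bounds the one-sided derivative of half the squared distance to \<open>x\<close>;
  it enters through a quadratic upper bound because the square of a general norm need not be
  differentiable. Minimality is expressed on the epigraph of \<open>g\<close>, through real upper bounds
  \<open>b\<close> of \<open>g v\<close>, so that the limit is taken in the reals.
\<close>

lemma prox_first_order:
  fixes D :: "'u::real_normed_vector \<Rightarrow>\<^sub>L real"
  assumes cvx: "convex_fun g" and gw: "g w = ereal a" and "0 \<le> L"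
    and min: "\<And>v b. g v \<le> ereal b \<Longrightarrow>
      a + D (w - x) + L / 2 * (norm (w - x))\<^sup>2 \<le> b + D (v - x) + L / 2 * (norm (v - x))\<^sup>2"
    and gv: "g v \<le> ereal b"
    and growth: "\<And>t. 0 < t \<Longrightarrow> t < 1 \<Longrightarrow>
      (norm ((1 - t) *\<^sub>R w + t *\<^sub>R v - x))\<^sup>2 \<le> (norm (w - x))\<^sup>2 + 2 * t * s + t\<^sup>2 * n\<^sup>2"
  shows "a - L * s \<le> b + D (v - w)"
proof -
  have approx: "a - L * s \<le> b + D (v - w) + t * (L / 2 * n\<^sup>2)" if t: "0 < t" "t < 1" for t
  proof -
    let ?v = "(1 - t) *\<^sub>R w + t *\<^sub>R v"
    have "a + D (w - x) + L / 2 * (norm (w - x))\<^sup>2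
        \<le> (1 - t) * a + t * b + D (?v - x) + L / 2 * (norm (?v - x))\<^sup>2"
      by (rule min[OF convex_fun_segment[OF cvx _ gv t]]) (simp add: gw)
    moreover have "L / 2 * (norm (?v - x))\<^sup>2
        \<le> L / 2 * ((norm (w - x))\<^sup>2 + 2 * t * s + t\<^sup>2 * n\<^sup>2)"
      using growth[OF t] \<open>0 \<le> L\<close> by (intro mult_left_mono) auto
    moreover have "D (?v - x) = D (w - x) + t * D (v - w)"
      by (simp add: blinfun.add_right blinfun.diff_right blinfun.scaleR_right algebra_simps)
    ultimately have "t * (a - L * s) \<le> t * (b + D (v - w) + t * (L / 2 * n\<^sup>2))"
      by (simp add: field_simps power2_eq_square)
    with t show ?thesis by simp
  qed
  have "((\<lambda>t. b + D (v - w) + t * (L / 2 * n\<^sup>2)) \<longlongrightarrow> b + D (v - w) + 0 * (L / 2 * n\<^sup>2)) (at_right 0)"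
    by (intro tendsto_intros)
  moreover have "eventually (\<lambda>t. a - L * s \<le> b + D (v - w) + t * (L / 2 * n\<^sup>2)) (at_right (0::real))"
    using approx unfolding eventually_at_right_field by (intro exI[of _ 1]) auto
  ultimately show ?thesis
    using tendsto_lowerbound[OF _ _ trivial_limit_at_right_real] by fastforce
qed

text \<open>
  Towards \<open>v = x\<close> the distance to \<open>x\<close> shrinks by the factor \<open>1 - t\<close>, so \<open>s = -\<parallel>w - x\<parallel>\<^sup>2\<close>; towards any
  other point the triangle inequality gives \<open>s = \<parallel>w - x\<parallel> \<parallel>v - w\<parallel>\<close>, a slope bound with constant
  \<open>L \<parallel>w - x\<parallel>\<close>.
\<close>

lemma prox_step:
  fixes D :: "'u::real_normed_vector \<Rightarrow>\<^sub>L real"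
  assumes cvx: "convex_fun g" and gw: "g w = ereal a" and "0 \<le> L"
    and min: "\<And>v b. g v \<le> ereal b \<Longrightarrow>
      a + D (w - x) + L / 2 * (norm (w - x))\<^sup>2 \<le> b + D (v - x) + L / 2 * (norm (v - x))\<^sup>2"
  shows prox_decrease: "g x \<le> ereal b \<Longrightarrow> a + D (w - x) + L * (norm (w - x))\<^sup>2 \<le> b"
    and prox_subgradient: "\<exists>\<xi>\<in>subdifferential g w. norm (D + \<xi>) \<le> L * norm (w - x)"
proof -
  assume gx: "g x \<le> ereal b"
  have "a - L * - (norm (w - x))\<^sup>2 \<le> b + D (x - w)"
  proof (rule prox_first_order[OF assms gx])
    fix t :: real
    assume "0 < t" "t < 1"
    have "(1 - t) *\<^sub>R w + t *\<^sub>R x - x = (1 - t) *\<^sub>R (w - x)"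
      by (simp add: algebra_simps)
    then have "(norm ((1 - t) *\<^sub>R w + t *\<^sub>R x - x))\<^sup>2 = ((1 - t) * norm (w - x))\<^sup>2"
      using \<open>t < 1\<close> by simp
    then show "(norm ((1 - t) *\<^sub>R w + t *\<^sub>R x - x))\<^sup>2
        \<le> (norm (w - x))\<^sup>2 + 2 * t * - (norm (w - x))\<^sup>2 + t\<^sup>2 * (norm (w - x))\<^sup>2"
      by (simp add: power2_eq_square algebra_simps)
  qed
  then show "a + D (w - x) + L * (norm (w - x))\<^sup>2 \<le> b"
    by (simp add: blinfun.diff_right)
next
  have "a - L * norm (w - x) * norm (v - w) \<le> b + D (v - w)" if gv: "g v \<le> ereal b" for v b
  proof -
    have "a - L * (norm (w - x) * norm (v - w)) \<le> b + D (v - w)"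
    proof (rule prox_first_order[OF assms gv])
      fix t :: real
      assume "0 < t" "t < 1"
      have "(1 - t) *\<^sub>R w + t *\<^sub>R v - x = (w - x) + t *\<^sub>R (v - w)"
        by (simp add: algebra_simps)
      then have "norm ((1 - t) *\<^sub>R w + t *\<^sub>R v - x) \<le> norm (w - x) + t * norm (v - w)"
        using norm_triangle_ineq[of "w - x" "t *\<^sub>R (v - w)"] \<open>0 < t\<close> by (metis abs_of_pos norm_scaleR)
      then have "(norm ((1 - t) *\<^sub>R w + t *\<^sub>R v - x))\<^sup>2 \<le> (norm (w - x) + t * norm (v - w))\<^sup>2"
        by (intro power_mono) auto
      then show "(norm ((1 - t) *\<^sub>R w + t *\<^sub>R v - x))\<^sup>2
          \<le> (norm (w - x))\<^sup>2 + 2 * t * (norm (w - x) * norm (v - w)) + t\<^sup>2 * (norm (v - w))\<^sup>2"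
        by (simp add: power2_eq_square algebra_simps)
    qed
    then show ?thesis by (simp add: mult.assoc)
  qed
  moreover have "0 \<le> L * norm (w - x)" using \<open>0 \<le> L\<close> by simp
  ultimately obtain \<xi> where "\<xi> \<in> subdifferential g w" "norm (D + \<xi>) \<le> L * norm (w - x)"
    using subgradient_near_functional[OF cvx gw] by blast
  then show "\<exists>\<xi>\<in>subdifferential g w. norm (D + \<xi>) \<le> L * norm (w - x)" by blast
qed

lemma norm_canonical_embedding_le:
  assumes "dual_identification \<Phi>"
  shows "norm (canonical_embedding \<Phi> y) \<le> norm y"
proof (rule norm_blinfun_bound)
  fix u
  have "norm (blinfun_apply (\<Phi> u) y) \<le> norm (\<Phi> u) * norm y"
    by (rule norm_blinfun)
  then show "norm (canonical_embedding \<Phi> y u) \<le> norm y * norm u"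
    using assms by (simp add: canonical_embedding.rep_eq pairing_def dual_identification_def mult.commute)
qed simp

lemma canonical_embedding_diff:
  "canonical_embedding \<Phi> y - canonical_embedding \<Phi> z = canonical_embedding \<Phi> (y - z)"
  by (rule blinfun_eqI)
    (simp add: canonical_embedding.rep_eq pairing_def blinfun.diff_left blinfun.diff_right)

text \<open>
  The function \<open>L \<mapsto> L / (2 (a + L)\<^sup>2)\<close> increases up to \<open>L = a\<close> and decreases afterwards, so its minimum
  over an interval is attained at an endpoint.
\<close>

lemma min_endpoints_le_step_factor:
  fixes a La Lb L :: real
  assumes "0 \<le> a" "0 < La" "La \<le> L" "L \<le> Lb"
  shows "min (La / (2 * (a + La)\<^sup>2)) (Lb / (2 * (a + Lb)\<^sup>2)) \<le> L / (2 * (a + L)\<^sup>2)"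
proof -
  have pos: "0 < (a + La)\<^sup>2" "0 < (a + L)\<^sup>2" "0 < (a + Lb)\<^sup>2"
    using assms by auto
  show ?thesis
  proof (cases "L \<le> a")
    case True
    have "La * L \<le> a * a" using assms True by (intro mult_mono) auto
    then have "0 \<le> (L - La) * (a * a - La * L)" using assms by simp
    then have "La * (a + L)\<^sup>2 \<le> L * (a + La)\<^sup>2"
      by (simp add: power2_eq_square algebra_simps)
    then have "La / (2 * (a + La)\<^sup>2) \<le> L / (2 * (a + L)\<^sup>2)"
      using pos by (simp add: divide_simps)
    then show ?thesis by simp
  next
    case False
    have "a * a \<le> L * Lb" using assms False by (intro mult_mono) auto
    then have "0 \<le> (Lb - L) * (L * Lb - a * a)" using assms by simp
    then have "Lb * (a + L)\<^sup>2 \<le> L * (a + Lb)\<^sup>2"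
      by (simp add: power2_eq_square algebra_simps)
    then have "Lb / (2 * (a + Lb)\<^sup>2) \<le> L / (2 * (a + L)\<^sup>2)"
      using pos by (simp add: divide_simps)
    then show ?thesis by simp
  qed
qed

text \<open>
  The step length \<open>\<parallel>w - x\<parallel>\<close> bounds the decrease of the objective from below by \<open>L/2 \<parallel>w - x\<parallel>\<^sup>2\<close> and the
  residual of the optimality condition at \<open>w\<close> from above by \<open>(Lf + L) \<parallel>w - x\<parallel>\<close>; the
  descent estimate eliminates it. The summand \<open>Lf\<close> pays for moving the gradient from \<open>x\<close> to \<open>w\<close>.
\<close>

lemma prox_grad_step:
  fixes \<Phi> :: "'u::real_normed_vector \<Rightarrow>\<^sub>L ('y::real_normed_vector \<Rightarrow>\<^sub>L real)"
  assumes dual: "dual_identification \<Phi>"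
    and g_nonneg: "\<And>v. 0 \<le> g v"
    and cvx: "convex_fun g"
    and "0 \<le> Lf"
    and lip: "\<And>v w. v \<in> edom g \<Longrightarrow> w \<in> edom g \<Longrightarrow> norm (gradf v - gradf w) \<le> Lf * norm (v - w)"
    and x: "x \<in> edom g" and "0 < L"
    and argmin: "is_arg_min (\<lambda>v. prox_model \<Phi> f gradf g L v x) (\<lambda>_. True) w"
    and accept: "objective f g w \<le> prox_model \<Phi> f gradf g L w x"
  shows prox_grad_step_edom: "w \<in> edom g"
    and prox_grad_step_descent: "\<exists>\<xi>\<in>subdifferential g w.
      L / (2 * (Lf + L)\<^sup>2) * (norm (canonical_embedding \<Phi> (gradf w) + \<xi>))\<^sup>2
        \<le> real_of_ereal (objective f g x) - real_of_ereal (objective f g w)"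
proof -
  let ?D = "canonical_embedding \<Phi> (gradf x)"
  let ?d = "norm (w - x)"
  have model: "prox_model \<Phi> f gradf g L v x = ereal (f x + ?D (v - x) + L / 2 * (norm (v - x))\<^sup>2) + g v"
    for v
    by (cases "g v") (simp_all add: prox_model_def canonical_embedding.rep_eq)
  have model_min: "prox_model \<Phi> f gradf g L w x \<le> prox_model \<Phi> f gradf g L v x" for v
    using argmin by (auto simp: is_arg_min_def not_less)
  obtain b where b: "g x = ereal b"
    using x g_nonneg[of x] by (cases "g x") (auto simp: edom_def)
  obtain a where a: "g w = ereal a"
    using model_min[of x] g_nonneg[of w] by (cases "g w") (auto simp: model b)
  show w: "w \<in> edom g" by (simp add: edom_def a)
  have min: "a + ?D (w - x) + L / 2 * ?d\<^sup>2 \<le> r + ?D (v - x) + L / 2 * (norm (v - x))\<^sup>2"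
    if "g v \<le> ereal r" for v r
    using that model_min[of v] g_nonneg[of v] by (cases "g v") (auto simp: model a)
  have "0 \<le> L" using \<open>0 < L\<close> by simp
  note step = prox_step[OF cvx a \<open>0 \<le> L\<close> min]
  have "a + ?D (w - x) + L * ?d\<^sup>2 \<le> b"
    by (rule step(1)) (simp_all add: b)
  moreover have "f w + a \<le> f x + ?D (w - x) + L / 2 * ?d\<^sup>2 + a"
    using accept by (simp add: model objective_def a)
  ultimately have descent: "L / 2 * ?d\<^sup>2 \<le> (f x + b) - (f w + a)"
    by simp
  obtain \<xi> where \<xi>: "\<xi> \<in> subdifferential g w" "norm (?D + \<xi>) \<le> L * ?d"
    using step(2) by blast
  let ?r = "canonical_embedding \<Phi> (gradf w) + \<xi>"
  have "?r = canonical_embedding \<Phi> (gradf w - gradf x) + (?D + \<xi>)"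
    by (simp add: canonical_embedding_diff[symmetric])
  then have "norm ?r \<le> norm (gradf w - gradf x) + norm (?D + \<xi>)"
    using norm_triangle_ineq norm_canonical_embedding_le[OF dual, of "gradf w - gradf x"]
    by (metis add_right_mono order_trans)
  also have "\<dots> \<le> (Lf + L) * ?d"
    using lip[OF w x] \<xi>(2) by (simp add: distrib_right)
  finally have "(norm ?r)\<^sup>2 \<le> ((Lf + L) * ?d)\<^sup>2"
    by (intro power_mono) auto
  then have "L / (2 * (Lf + L)\<^sup>2) * (norm ?r)\<^sup>2 \<le> L / (2 * (Lf + L)\<^sup>2) * ((Lf + L) * ?d)\<^sup>2"
    using \<open>0 < L\<close> by (intro mult_left_mono) auto
  also have "\<dots> = L / 2 * ?d\<^sup>2"
    using \<open>0 < L\<close> \<open>0 \<le> Lf\<close> by (simp add: power_mult_distrib)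
  finally show "\<exists>\<xi>\<in>subdifferential g w.
      L / (2 * (Lf + L)\<^sup>2) * (norm (canonical_embedding \<Phi> (gradf w) + \<xi>))\<^sup>2
        \<le> real_of_ereal (objective f g x) - real_of_ereal (objective f g w)"
    using \<xi>(1) descent by (intro bexI[of _ \<xi>]) (auto simp: objective_def a b)
qed

section \<open>The convergence rate\<close>

text \<open>The decreases telescope, and the smallest of them is at most their average.\<close>

lemma small_decrease_exists:
  fixes J :: "nat \<Rightarrow> real"
  obtains l where "l \<le> k" "real (k + 1) * (J l - J (Suc l)) \<le> J 0 - J (Suc k)"
proof (rule ccontr)
  assume "\<not> thesis"
  then have large: "J 0 - J (Suc k) < real (k + 1) * (J l - J (Suc l))" if "l \<le> k" for l
    using that \<open>\<And>l. l \<le> k \<Longrightarrow> real (k + 1) * (J l - J (Suc l)) \<le> J 0 - J (Suc k) \<Longrightarrow> thesis\<close>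
    by force
  have "(\<Sum>l\<le>k. J 0 - J (Suc k)) < (\<Sum>l\<le>k. real (k + 1) * (J l - J (Suc l)))"
    using large by (intro sum_strict_mono) auto
  also have "\<dots> = real (k + 1) * (J 0 - J (Suc k))"
    by (simp add: sum_distrib_left[symmetric] sum_telescope)
  finally show False by simp
qed

theorem theorem4p3:
  fixes \<Phi> :: "'u::real_normed_vector \<Rightarrow>\<^sub>L ('y::banach \<Rightarrow>\<^sub>L real)"
    and f :: "'u \<Rightarrow> real"
    and g :: "'u \<Rightarrow> ereal"
    and gradf :: "'u \<Rightarrow> 'y"
    and Lf La Lb :: real
    and u :: "nat \<Rightarrow> 'u"
    and k :: nat
  assumes separable: "separable_space (euclidean :: 'y topology)"
    and dual: "dual_identification \<Phi>"
    and g_nonneg: "\<And>v. 0 \<le> g v"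
    and g_proper: "proper_fun g"
    and g_convex: "convex_fun g"
    and g_lsc: "seq_weakstar_lsc_on \<Phi> UNIV g"
    and f_nonneg: "\<And>v. 0 \<le> f v"
    and f_lsc: "seq_weakstar_lsc_on \<Phi> (edom g) (\<lambda>v. ereal (f v))"
    and f_gateaux: "\<exists>N. edom g \<subseteq> interior N \<and> (\<forall>v\<in>N. \<exists>D. has_gateaux_derivative f D v)"
    and f_gradient: "\<And>v. v \<in> edom g \<Longrightarrow> has_gateaux_derivative f (canonical_embedding \<Phi> (gradf v)) v"
    and Lf_nonneg: "0 \<le> Lf"
    and gradient_lipschitz: "\<And>v w. v \<in> edom g \<Longrightarrow> w \<in> edom g \<Longrightarrow>
      norm (gradf v - gradf w) \<le> Lf * norm (v - w)"
    and coercive: "\<And>x :: nat \<Rightarrow> 'u. filterlim (\<lambda>n. norm (x n)) at_top sequentially \<Longrightarrow>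
      (\<lambda>n. objective f g (x n)) \<longlonglongrightarrow> \<infinity>"
    and step_bounds: "0 < La" "La \<le> Lb"
    and algorithm: "prox_grad_sequence \<Phi> f gradf g La Lb u"
  shows "(INF l\<in>{0..k}. INF \<xi>\<in>subdifferential g (u (l + 1)).
            ereal (norm (canonical_embedding \<Phi> (gradf (u (l + 1))) + \<xi>)))
         \<le> ereal (sqrt (real_of_ereal (residual f g (u 0)) /
              (min (La / (2 * (Lf + La)\<^sup>2)) (Lb / (2 * (Lf + Lb)\<^sup>2)) * real (k + 1))))"
proof -
  let ?\<nu> = "min (La / (2 * (Lf + La)\<^sup>2)) (Lb / (2 * (Lf + Lb)\<^sup>2))"
  let ?res = "\<lambda>l \<xi>. norm (canonical_embedding \<Phi> (gradf (u (l + 1))) + \<xi>)"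
  define J where "J l = real_of_ereal (objective f g (u l))" for l
  have step: "u (Suc l) \<in> edom g \<and> (\<exists>\<xi>\<in>subdifferential g (u (Suc l)). ?\<nu> * (?res l \<xi>)\<^sup>2 \<le> J l - J (Suc l))"
    if dom: "u l \<in> edom g" for l
  proof -
    obtain L where L: "La \<le> L" "L \<le> Lb"
      and argmin: "is_arg_min (\<lambda>v. prox_model \<Phi> f gradf g L v (u l)) (\<lambda>_. True) (u (Suc l))"
      and accept: "objective f g (u (Suc l)) \<le> prox_model \<Phi> f gradf g L (u (Suc l)) (u l)"
      using algorithm unfolding prox_grad_sequence_def by force
    have "0 < L" using L step_bounds by simp
    note prox = prox_grad_step[OF dual g_nonneg g_convex Lf_nonneg gradient_lipschitz dom
      \<open>0 < L\<close> argmin accept]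
    obtain \<xi> where \<xi>: "\<xi> \<in> subdifferential g (u (Suc l))"
        "L / (2 * (Lf + L)\<^sup>2) * (?res l \<xi>)\<^sup>2 \<le> J l - J (Suc l)"
      using prox(2) by (auto simp: J_def)
    have "?\<nu> * (?res l \<xi>)\<^sup>2 \<le> L / (2 * (Lf + L)\<^sup>2) * (?res l \<xi>)\<^sup>2"
      using min_endpoints_le_step_factor[OF Lf_nonneg step_bounds(1) L] by (rule mult_right_mono) simp
    with \<xi> prox(1) show ?thesis by force
  qed
  have dom: "u l \<in> edom g" for l
  proof (induction l)
    case 0
    show ?case using algorithm by (simp add: prox_grad_sequence_def)
  next
    case (Suc l)
    then show ?case using step by blast
  qed
  have J: "objective f g (u l) = ereal (J l)" for l
    using dom[of l] g_nonneg[of "u l"] by (cases "g (u l)") (auto simp: J_def objective_def edom_def)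
  let ?inf = "INF v. objective f g v"
  have "0 \<le> ?inf"
    using f_nonneg g_nonneg by (intro INF_greatest) (simp add: objective_def)
  moreover have "?inf \<le> ereal (J l)" for l
    unfolding J[symmetric] by (rule INF_lower) simp
  ultimately obtain i where i: "?inf = ereal i" "\<And>l. i \<le> J l"
    by (cases ?inf) auto
  have residual: "real_of_ereal (residual f g (u 0)) = J 0 - i"
    by (simp add: residual_def J i(1))
  obtain l where l: "l \<le> k" "real (k + 1) * (J l - J (Suc l)) \<le> J 0 - J (Suc k)"
    by (rule small_decrease_exists)
  obtain \<xi> where \<xi>: "\<xi> \<in> subdifferential g (u (l + 1))" "?\<nu> * (?res l \<xi>)\<^sup>2 \<le> J l - J (Suc l)"
    using step[OF dom, of l] by auto
  have \<nu>: "0 < ?\<nu>"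
    using step_bounds Lf_nonneg by (auto intro!: divide_pos_pos)
  have "real (k + 1) * (?\<nu> * (?res l \<xi>)\<^sup>2) \<le> real (k + 1) * (J l - J (Suc l))"
    using \<xi>(2) by (intro mult_left_mono) auto
  also have "\<dots> \<le> J 0 - i"
    using l(2) i(2)[of "Suc k"] by simp
  finally have "(?res l \<xi>)\<^sup>2 * (?\<nu> * real (k + 1)) \<le> J 0 - i"
    by (simp add: mult_ac)
  then have "(?res l \<xi>)\<^sup>2 \<le> (J 0 - i) / (?\<nu> * real (k + 1))"
    using \<nu> by (subst pos_le_divide_eq) auto
  then have rate: "?res l \<xi> \<le> sqrt (real_of_ereal (residual f g (u 0)) / (?\<nu> * real (k + 1)))"
    unfolding residual by (rule real_le_rsqrt)
  have "(INF l\<in>{0..k}. INF \<xi>\<in>subdifferential g (u (l + 1)). ereal (?res l \<xi>)) \<le> ereal (?res l \<xi>)"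
    using l(1) \<xi>(1) by (intro INF_lower2[of l] INF_lower) auto
  also have "\<dots> \<le> ereal (sqrt (real_of_ereal (residual f g (u 0)) / (?\<nu> * real (k + 1))))"
    using rate by simp
  finally show ?thesis .
qed

end
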